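(* Let $(S,* )$ be an adequate partial semigroup. For each $k\in\mathbb{N}$, if $k\text{-}CR(S)\neq\emptyset$, then $k\text{-}CR(S)$ is a compact two-sided ideal of $\delta S$. Consequently, if $CR(S)\neq\emptyset$, then $CR(S)$ is a compact two-sided ideal of $\delta S$.
   Context: A partial semigroup is a pair $(S,* )$ where $S$ is a nonempty set and $*$ is an operation defined on a nonempty subset of $S\times S$ such that for all $x,y,z\in S$, $(x*y)*z=x*(y*z)$ in the sense that if either side is defined then so is the other and they are equal. For $a\in S$, $\varphi(a)=\{b\in S: a*b \text{ is defined}\}$; for finite nonempty $F\subseteq S$, $\sigma(F)=\bigcap_{a\in F}\varphi(a)$. $(S,* )$ is adequate if $\sigma(F)\neq\emptyset$ for all finite nonempty $F$. $\mathcal{P}_f(X)$ denotes the set of finite nonempty subsets of $X$. Products $\prod_{t\in H}f(t)$ are computed in increasing order of indices. A sequence $f:\mathbb{N}\to S$ is adequate if (i) for each $H\in\mathcal{P}_f(\mathbb{N})$, $\prod_{t\in H}f(t)$ is defined, and (ii) for each $F\in\mathcal{P}_f(S)$ there is $m\in\mathbb{N}$ such that $\prod_{t\in H}f(t)\in\sigma(F)$ for all $H\in\mathcal{P}_f(\mathbb{N})$ with $\min H\geq m$. $\mathcal{T}$ denotes the set of adequate sequences, and $\mathcal{P}_f(\mathcal{T})_{\leq k}=\{F\in\mathcal{P}_f(\mathcal{T}): |F|\leq k\}$. For $k\in\mathbb{N}$, $A\subseteq S$ is a $k$-CR set if for every $L\in\mathcal{P}_f(S)$ there is $r\in\mathbb{N}$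 such that for every $F\in\mathcal{P}_f(\mathcal{T})_{\leq k}$ there exist $m\in\mathbb{N}$, $a\in S^{m+1}$ and $t(1)<\dots<t(m)\leq r$ in $\mathbb{N}$ such that for all $f\in F$, $a(1)*f(t(1))*a(2)*\dots*a(m)*f(t(m))*a(m+1)$ is defined and lies in $A\cap\sigma(L)$; $A$ is a CR set if it is $k$-CR for all $k$. $\beta S$ is the set of ultrafilters on $S$ with the Stone–Čech topology, $\overline{A}=\{p\in\beta S:A\in p\}$, $\delta S=\bigcap_{F\in\mathcal{P}_f(S)}\overline{\sigma(F)}$, $x^{-1}A=\{y\in\varphi(x):x*y\in A\}$, and for $p,q\in\delta S$, $p*q=\{A\subseteq S:\{x\in S:x^{-1}A\in q\}\in p\}$; this makes $\delta S$ a compact Hausdorff right topological semigroup. $k\text{-}CR(S)=\{p\in\delta S:\text{every } A\in p \text{ is a } k\text{-CR set}\}$ and $CR(S)=\{p\in\delta S:\text{every } A\in p\text{ is a CR set}\}$. *)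

theory Defs
  imports "HOL-Analysis.Analysis"
begin

text \<open>
  A partial operation on a carrier \<open>S\<close> is a function \<open>mul\<close> into an option type, where \<open>None\<close>
  means ``undefined''. Only the values of \<open>mul\<close> on \<open>S \<times> S\<close> matter. The natural numbers are
  the positive integers throughout.
\<close>

definition Pf :: "'a set \<Rightarrow> 'a set set" where
  "Pf X = {F. F \<subseteq> X \<and> finite F \<and> F \<noteq> {}}"

subsection \<open>Partial semigroups\<close>

definition partial_semigroup :: "'a set \<Rightarrow> ('a \<Rightarrow> 'a \<Rightarrow> 'a option) \<Rightarrow> bool" where
  "partial_semigroup S mul \<longleftrightarrow>
     S \<noteq> {} \<and>
     (\<exists>x\<in>S. \<exists>y\<in>S. mul x y \<noteq> None) \<and>
     (\<forall>x\<in>S. \<forall>y\<in>S. \<forall>z. mul x y = Some z \<longrightarrow> z \<in> S) \<and>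
     (\<forall>x\<in>S. \<forall>y\<in>S. \<forall>z\<in>S.
        Option.bind (mul x y) (\<lambda>u. mul u z) = Option.bind (mul y z) (\<lambda>v. mul x v))"

definition phi :: "'a set \<Rightarrow> ('a \<Rightarrow> 'a \<Rightarrow> 'a option) \<Rightarrow> 'a \<Rightarrow> 'a set" where
  "phi S mul a = {b\<in>S. mul a b \<noteq> None}"

definition sigma :: "'a set \<Rightarrow> ('a \<Rightarrow> 'a \<Rightarrow> 'a option) \<Rightarrow> 'a set \<Rightarrow> 'a set" where
  "sigma S mul F = (\<Inter>a\<in>F. phi S mul a)"

definition adequate_partial_semigroup :: "'a set \<Rightarrow> ('a \<Rightarrow> 'a \<Rightarrow> 'a option) \<Rightarrow> bool" where
  "adequate_partial_semigroup S mul \<longleftrightarrow>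
     partial_semigroup S mul \<and> (\<forall>F\<in>Pf S. sigma S mul F \<noteq> {})"

text \<open>
  The product of a nonempty list, \<open>None\<close> if undefined. By partial associativity the bracketing
  does not matter. The empty list has no product.
\<close>

fun pprod :: "('a \<Rightarrow> 'a \<Rightarrow> 'a option) \<Rightarrow> 'a list \<Rightarrow> 'a option" where
  "pprod mul [] = None"
| "pprod mul [x] = Some x"
| "pprod mul (x # y # xs) = Option.bind (pprod mul (y # xs)) (\<lambda>z. mul x z)"

definition set_prod :: "('a \<Rightarrow> 'a \<Rightarrow> 'a option) \<Rightarrow> (nat \<Rightarrow> 'a) \<Rightarrow> nat set \<Rightarrow> 'a option" where
  "set_prod mul f H = pprod mul (map f (sorted_list_of_set H))"

text \<open>
  Sequences are elements of the extensional function space \<open>{1..} \<rightarrow>\<^sub>E S\<close>, so that distinct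
  elements of \<open>adequate_seqs\<close> differ at some positive index and cardinalities of sets of
  sequences are the intended ones.
\<close>

definition adequate_seqs :: "'a set \<Rightarrow> ('a \<Rightarrow> 'a \<Rightarrow> 'a option) \<Rightarrow> (nat \<Rightarrow> 'a) set" where
  "adequate_seqs S mul = {f \<in> {1..} \<rightarrow>\<^sub>E S.
     (\<forall>H\<in>Pf {1..}. set_prod mul f H \<noteq> None) \<and>
     (\<forall>F\<in>Pf S. \<exists>m\<ge>1. \<forall>H\<in>Pf {1..}. Min H \<ge> m \<longrightarrow>
        (\<exists>y\<in>sigma S mul F. set_prod mul f H = Some y))}"

subsection \<open>CR sets\<close>

text \<open>\<open>a(1) * f(t(1)) * a(2) * \<dots> * a(m) * f(t(m)) * a(m+1)\<close>\<close>

definition interleaved_prod ::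
  "('a \<Rightarrow> 'a \<Rightarrow> 'a option) \<Rightarrow> nat \<Rightarrow> (nat \<Rightarrow> 'a) \<Rightarrow> (nat \<Rightarrow> nat) \<Rightarrow> (nat \<Rightarrow> 'a) \<Rightarrow> 'a option" where
  "interleaved_prod mul m a t f =
     pprod mul (concat (map (\<lambda>i. [a i, f (t i)]) [1..<m+1]) @ [a (m+1)])"

definition k_CR_set :: "'a set \<Rightarrow> ('a \<Rightarrow> 'a \<Rightarrow> 'a option) \<Rightarrow> nat \<Rightarrow> 'a set \<Rightarrow> bool" where
  "k_CR_set S mul k A \<longleftrightarrow>
     A \<subseteq> S \<and>
     (\<forall>L\<in>Pf S. \<exists>r\<ge>1. \<forall>F\<in>Pf (adequate_seqs S mul). card F \<le> k \<longrightarrow>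
        (\<exists>m\<ge>1. \<exists>a \<in> {1..m+1} \<rightarrow> S. \<exists>t \<in> {1..m} \<rightarrow> {1..r}. strict_mono_on {1..m} t \<and>
           (\<forall>f\<in>F. \<exists>y \<in> A \<inter> sigma S mul L. interleaved_prod mul m a t f = Some y)))"

definition CR_set :: "'a set \<Rightarrow> ('a \<Rightarrow> 'a \<Rightarrow> 'a option) \<Rightarrow> 'a set \<Rightarrow> bool" where
  "CR_set S mul A \<longleftrightarrow> (\<forall>k\<ge>1. k_CR_set S mul k A)"

subsection \<open>Ultrafilters\<close>

definition ultrafilter_on :: "'a set \<Rightarrow> 'a set set \<Rightarrow> bool" where
  "ultrafilter_on S p \<longleftrightarrow>
     p \<subseteq> Pow S \<and> S \<in> p \<and> {} \<notin> p \<and>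
     (\<forall>A\<in>p. \<forall>B\<in>p. A \<inter> B \<in> p) \<and>
     (\<forall>A\<in>p. \<forall>B. A \<subseteq> B \<and> B \<subseteq> S \<longrightarrow> B \<in> p) \<and>
     (\<forall>A. A \<subseteq> S \<longrightarrow> A \<in> p \<or> S - A \<in> p)"

definition beta :: "'a set \<Rightarrow> 'a set set set" where
  "beta S = {p. ultrafilter_on S p}"

definition beta_cl :: "'a set \<Rightarrow> 'a set \<Rightarrow> 'a set set set" where
  "beta_cl S A = {p \<in> beta S. A \<in> p}"

definition beta_top :: "'a set \<Rightarrow> 'a set set topology" where
  "beta_top S = topology_generated_by {beta_cl S A |A. A \<subseteq> S}"

definition delta :: "'a set \<Rightarrow> ('a \<Rightarrow> 'a \<Rightarrow> 'a option) \<Rightarrow> 'a set set set" where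
  "delta S mul = (\<Inter>F\<in>Pf S. beta_cl S (sigma S mul F))"

definition delta_top :: "'a set \<Rightarrow> ('a \<Rightarrow> 'a \<Rightarrow> 'a option) \<Rightarrow> 'a set set topology" where
  "delta_top S mul = subtopology (beta_top S) (delta S mul)"

text \<open>\<open>x\<^sup>-\<^sup>1A\<close>\<close>

definition left_quot :: "'a set \<Rightarrow> ('a \<Rightarrow> 'a \<Rightarrow> 'a option) \<Rightarrow> 'a \<Rightarrow> 'a set \<Rightarrow> 'a set" where
  "left_quot S mul x A = {y \<in> phi S mul x. \<exists>z\<in>A. mul x y = Some z}"

definition uf_mult ::
  "'a set \<Rightarrow> ('a \<Rightarrow> 'a \<Rightarrow> 'a option) \<Rightarrow> 'a set set \<Rightarrow> 'a set set \<Rightarrow> 'a set set" where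
  "uf_mult S mul p q = {A. A \<subseteq> S \<and> {x\<in>S. left_quot S mul x A \<in> q} \<in> p}"

definition k_CR :: "'a set \<Rightarrow> ('a \<Rightarrow> 'a \<Rightarrow> 'a option) \<Rightarrow> nat \<Rightarrow> 'a set set set" where
  "k_CR S mul k = {p \<in> delta S mul. \<forall>A\<in>p. k_CR_set S mul k A}"

definition CR :: "'a set \<Rightarrow> ('a \<Rightarrow> 'a \<Rightarrow> 'a option) \<Rightarrow> 'a set set set" where
  "CR S mul = {p \<in> delta S mul. \<forall>A\<in>p. CR_set S mul A}"

definition two_sided_ideal :: "'b set \<Rightarrow> ('b \<Rightarrow> 'b \<Rightarrow> 'b) \<Rightarrow> 'b set \<Rightarrow> bool" where
  "two_sided_ideal T opn I \<longleftrightarrow>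
     I \<noteq> {} \<and> I \<subseteq> T \<and> (\<forall>p\<in>T. \<forall>q\<in>I. opn p q \<in> I \<and> opn q p \<in> I)"

end

theory Submission
  imports Defs
begin

text \<open>
  A factor multiplied onto an interleaved product \<open>a(1) * f(t(1)) * \<dots> * f(t(m)) * a(m+1)\<close> from
  the left or from the right is absorbed into \<open>a(1)\<close> or \<open>a(m+1)\<close>, without changing \<open>t\<close>. From the
  left, the same factor works for all \<open>f\<close> because it can be chosen before \<open>F\<close>; from the right, one
  factor \<open>z\<close> suits the finitely many products \<open>y\<^sub>f\<close> at once because the sets \<open>y\<^sub>f\<^sup>-\<^sup>1A\<close> lie in
  one ultrafilter. The condition \<open>\<sigma>(L)\<close> is carried along by replacing \<open>L\<close> with \<open>{x} \<union> L * x\<close>.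
  Compactness holds because sets of the form \<open>{p \<in> \<delta>S. every A \<in> p satisfies P}\<close> are closed
  in the compact space \<open>\<beta>S\<close>.
\<close>

section \<open>Ultrafilters and compactness\<close>

lemma ultrafilter_onD:
  assumes "ultrafilter_on S p"
  shows ultrafilter_on_subset: "A \<in> p \<Longrightarrow> A \<subseteq> S"
    and ultrafilter_on_carrier: "S \<in> p"
    and ultrafilter_on_empty: "{} \<notin> p"
    and ultrafilter_on_Int: "A \<in> p \<Longrightarrow> B \<in> p \<Longrightarrow> A \<inter> B \<in> p"
    and ultrafilter_on_mono: "A \<in> p \<Longrightarrow> A \<subseteq> B \<Longrightarrow> B \<subseteq> S \<Longrightarrow> B \<in> p"
    and ultrafilter_on_Diff: "A \<subseteq> S \<Longrightarrow> A \<notin> p \<Longrightarrow> S - A \<in> p"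
  using assms unfolding ultrafilter_on_def by blast+

lemma ultrafilter_on_Diff_iff:
  assumes "ultrafilter_on S p" "A \<subseteq> S"
  shows "S - A \<in> p \<longleftrightarrow> A \<notin> p"
proof
  assume D: "S - A \<in> p"
  show "A \<notin> p"
  proof
    assume "A \<in> p"
    then have "A \<inter> (S - A) \<in> p" using D assms(1) ultrafilter_on_Int by blast
    moreover have "A \<inter> (S - A) = {}" by blast
    ultimately show False using ultrafilter_on_empty[OF assms(1)] by metis
  qed
qed (use assms ultrafilter_on_Diff in blast)

lemma ultrafilter_on_finite_INT:
  assumes "ultrafilter_on S p" "finite I" "\<And>i. i \<in> I \<Longrightarrow> X i \<in> p"
  shows "S \<inter> (\<Inter>i\<in>I. X i) \<in> p"
  using assms(2,3)
proof (induction I rule: finite_induct)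
  case empty
  then show ?case using ultrafilter_on_carrier[OF assms(1)] by simp
next
  case (insert i I)
  then have "X i \<inter> (S \<inter> (\<Inter>i\<in>I. X i)) \<in> p"
    using ultrafilter_on_Int[OF assms(1)] by simp
  moreover have "X i \<inter> (S \<inter> (\<Inter>i\<in>I. X i)) = S \<inter> (\<Inter>i\<in>insert i I. X i)" by auto
  ultimately show ?case by metis
qed

section \<open>Extending families with the finite intersection property to ultrafilters\<close>

text \<open>Intersecting with \<open>S\<close> gives the empty subfamily the value \<open>S\<close>
  instead of the whole type, so the property forces \<open>S\<close> to be nonempty.\<close>

definition has_fip :: "'a set \<Rightarrow> 'a set set \<Rightarrow> bool" where
  "has_fip S \<F> \<longleftrightarrow> \<F> \<subseteq> Pow S \<and> (\<forall>\<G>. finite \<G> \<and> \<G> \<subseteq> \<F> \<longrightarrow> S \<inter> \<Inter>\<G> \<noteq> {})"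

lemma has_fipD:
  assumes "has_fip S \<F>"
  shows has_fip_subset: "A \<in> \<F> \<Longrightarrow> A \<subseteq> S"
    and has_fip_Inter: "finite \<G> \<Longrightarrow> \<G> \<subseteq> \<F> \<Longrightarrow> S \<inter> \<Inter>\<G> \<noteq> {}"
  using assms unfolding has_fip_def by auto

lemma has_fip_insert:
  assumes "has_fip S M" "A \<subseteq> S" "\<And>\<G>. finite \<G> \<Longrightarrow> \<G> \<subseteq> M \<Longrightarrow> S \<inter> A \<inter> \<Inter>\<G> \<noteq> {}"
  shows "has_fip S (insert A M)"
  unfolding has_fip_def
proof (intro conjI allI impI)
  show "insert A M \<subseteq> Pow S" using assms(2) has_fip_subset[OF assms(1)] by auto
next
  fix \<G> assume \<G>: "finite \<G> \<and> \<G> \<subseteq> insert A M"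
  then have "S \<inter> A \<inter> \<Inter>(\<G> - {A}) \<noteq> {}" by (intro assms(3)) auto
  then show "S \<inter> \<Inter>\<G> \<noteq> {}" by blast
qed

text \<open>Maximality puts into \<open>M\<close> every subset of \<open>S\<close> that contains a
  finite intersection of members; the filter laws are instances of this. If \<open>A\<close> cannot
  be added to \<open>M\<close>, some finite intersection misses \<open>A\<close>, so it lies in
  \<open>S - A\<close>, which is then a member.\<close>

lemma maximal_fip_ultrafilter:
  assumes M: "has_fip S M" and max: "\<And>X. has_fip S X \<Longrightarrow> M \<subseteq> X \<Longrightarrow> X = M"
  shows "ultrafilter_on S M"
proof -
  have fip: "S \<inter> \<Inter>\<G> \<noteq> {}" if "finite \<G>" "\<G> \<subseteq> M" for \<G>
    using M that unfolding has_fip_def by blast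
  have sub: "M \<subseteq> Pow S" using M unfolding has_fip_def by blast
  have mem: "B \<in> M" if "B \<subseteq> S" "finite \<H>" "\<H> \<subseteq> M" "S \<inter> \<Inter>\<H> \<subseteq> B" for B \<H>
  proof -
    have "has_fip S (insert B M)"
    proof (rule has_fip_insert[OF M that(1)])
      fix \<G> assume "finite \<G>" "\<G> \<subseteq> M"
      then have "S \<inter> \<Inter>(\<G> \<union> \<H>) \<noteq> {}" using that by (intro fip) auto
      then show "S \<inter> B \<inter> \<Inter>\<G> \<noteq> {}" using that(4) by blast
    qed
    then show ?thesis using max by blast
  qed
  show ?thesis
    unfolding ultrafilter_on_def
  proof (intro conjI ballI allI impI)
    show "M \<subseteq> Pow S" by (rule sub)
    show "S \<in> M" by (rule mem[of _ "{}"]) auto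
    show "{} \<notin> M" using fip[of "{{}}"] by auto
  next
    fix A B assume "A \<in> M" "B \<in> M"
    then show "A \<inter> B \<in> M" using sub by (intro mem[of _ "{A, B}"]) auto
  next
    fix A B assume "A \<in> M" "A \<subseteq> B \<and> B \<subseteq> S"
    then show "B \<in> M" by (intro mem[of _ "{A}"]) auto
  next
    fix A assume A: "A \<subseteq> S"
    show "A \<in> M \<or> S - A \<in> M"
    proof (cases "\<exists>\<G>. finite \<G> \<and> \<G> \<subseteq> M \<and> S \<inter> A \<inter> \<Inter>\<G> = {}")
      case True
      then obtain \<G> where "finite \<G>" "\<G> \<subseteq> M" "S \<inter> A \<inter> \<Inter>\<G> = {}" by blast
      then have "S - A \<in> M" by (intro mem[of _ \<G>]) auto
      then show ?thesis ..
    next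
      case False
      then have "has_fip S (insert A M)" by (intro has_fip_insert[OF M A]) blast
      then show ?thesis using max by blast
    qed
  qed
qed

text \<open>Zorn's lemma applies because a finite subfamily of the union of a chain already lies in
  one member of the chain.\<close>

lemma has_fip_extends_to_ultrafilter:
  assumes "has_fip S \<F>"
  obtains p where "ultrafilter_on S p" "\<F> \<subseteq> p"
proof -
  let ?A = "{X. has_fip S X \<and> \<F> \<subseteq> X}"
  have "\<exists>M\<in>?A. \<forall>X\<in>?A. M \<subseteq> X \<longrightarrow> X = M"
  proof (rule subset_Zorn_nonempty)
    show "?A \<noteq> {}" using assms by blast
  next
    fix \<C> assume ne: "\<C> \<noteq> {}" and ch: "subset.chain ?A \<C>"
    then have sub: "\<C> \<subseteq> ?A" by (simp add: subset.chain_def)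
    have "S \<inter> \<Inter>\<G> \<noteq> {}" if fin: "finite \<G>" "\<G> \<subseteq> \<Union>\<C>" for \<G>
    proof -
      obtain X where X: "X \<in> \<C>" "\<G> \<subseteq> X"
        using finite_subset_Union_chain[OF fin ne ch] .
      then have "has_fip S X" using sub by blast
      then show ?thesis using fin(1) X(2) by (rule has_fip_Inter)
    qed
    moreover have "\<Union>\<C> \<subseteq> Pow S"
    proof
      fix A assume "A \<in> \<Union>\<C>"
      then obtain X where "X \<in> \<C>" "A \<in> X" by blast
      then show "A \<in> Pow S" using sub has_fip_subset by blast
    qed
    moreover have "\<F> \<subseteq> \<Union>\<C>" using sub ne by blast
    ultimately show "\<Union>\<C> \<in> ?A" by (simp add: has_fip_def)
  qed
  then obtain M where M: "has_fip S M" "\<F> \<subseteq> M"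
    and max: "\<forall>X\<in>?A. M \<subseteq> X \<longrightarrow> X = M"
    by blast
  have "ultrafilter_on S M"
    using M max by (intro maximal_fip_ultrafilter) auto
  then show thesis using M(2) by (rule that)
qed

section \<open>The topology of beta S and its compactness\<close>

lemma topspace_beta_top [simp]: "topspace (beta_top S) = beta S"
  unfolding beta_top_def topology_generated_by_topspace
  by (auto simp: beta_cl_def beta_def dest: ultrafilter_on_carrier)

lemma beta_cl_iff: "p \<in> beta_cl S A \<longleftrightarrow> ultrafilter_on S p \<and> A \<in> p"
  unfolding beta_cl_def beta_def by simp

lemma openin_beta_cl: "A \<subseteq> S \<Longrightarrow> openin (beta_top S) (beta_cl S A)"
  unfolding beta_top_def by (rule topology_generated_by_Basis) blast

text \<open>The generating sets are a base and not merely a subbase: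
  \<open>beta_cl S (A \<inter> B)\<close> lies inside both \<open>beta_cl S A\<close> and
  \<open>beta_cl S B\<close>. The induction follows the generation of the open sets.\<close>

lemma openin_beta_topD:
  assumes "openin (beta_top S) U" "p \<in> U"
  shows "\<exists>A\<subseteq>S. A \<in> p \<and> beta_cl S A \<subseteq> U"
proof -
  have p: "ultrafilter_on S p"
    using assms openin_subset by (fastforce simp: beta_def)
  have "generate_topology_on {beta_cl S A |A. A \<subseteq> S} U"
    using assms(1) unfolding beta_top_def by (rule openin_topology_generated_by)
  then show ?thesis using assms(2)
  proof induction
    case (Int U V)
    then obtain A B where AB: "A \<subseteq> S" "A \<in> p" "beta_cl S A \<subseteq> U" "B \<subseteq> S" "B \<in> p" "beta_cl S B \<subseteq> V"
      by (metis IntD1 IntD2)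
    have "beta_cl S (A \<inter> B) \<subseteq> beta_cl S A \<inter> beta_cl S B"
      using AB(1,4) ultrafilter_on_mono unfolding beta_cl_def beta_def by blast
    then show ?case using AB ultrafilter_on_Int[OF p AB(2,5)] by (intro exI[of _ "A \<inter> B"]) blast
  next
    case (UN K)
    then obtain k where k: "k \<in> K" "p \<in> k" by blast
    then obtain A where "A \<subseteq> S" "A \<in> p" "beta_cl S A \<subseteq> k" using UN.IH by blast
    then show ?case using k(1) by blast
  next
    case (Basis U)
    then obtain A where "A \<subseteq> S" "U = beta_cl S A" by blast
    then show ?case using Basis.prems by (auto simp: beta_cl_iff)
  qed simp
qed

text \<open>Call \<open>A\<close> small if \<open>beta_cl S A\<close> fits into one member of the
  cover. Without a finite subcover, the complements of small sets have the finite intersection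
  property. An ultrafilter containing all these complements lies in some member of the cover, so it
  also contains a small set, a contradiction.\<close>

lemma compact_space_beta_top: "compact_space (beta_top S)"
  unfolding compact_space_alt
proof (intro allI impI, elim conjE, rule ccontr)
  fix \<U> assume op: "\<forall>U\<in>\<U>. openin (beta_top S) U" and cov: "topspace (beta_top S) \<subseteq> \<Union>\<U>"
    and neg: "\<nexists>\<F>. finite \<F> \<and> \<F> \<subseteq> \<U> \<and> topspace (beta_top S) \<subseteq> \<Union>\<F>"
  define E where "E = {A. A \<subseteq> S \<and> (\<exists>U\<in>\<U>. beta_cl S A \<subseteq> U)}"
  have "has_fip S ((-) S ` E)"
    unfolding has_fip_def
  proof (intro conjI allI impI)
    fix \<G> assume "finite \<G> \<and> \<G> \<subseteq> (-) S ` E"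
    then obtain H where H: "H \<subseteq> E" "finite H" "\<G> = (-) S ` H"
      by (meson finite_subset_image)
    then have "\<forall>A\<in>H. \<exists>U\<in>\<U>. beta_cl S A \<subseteq> U" unfolding E_def by blast
    then obtain u where u: "\<And>A. A \<in> H \<Longrightarrow> u A \<in> \<U> \<and> beta_cl S A \<subseteq> u A" by metis
    \<comment> \<open>A point missed by finitely many cover members contains all the corresponding
      complements, so their intersection belongs to an ultrafilter and is nonempty.\<close>
    have "\<not> topspace (beta_top S) \<subseteq> \<Union>(u ` H)" using neg H u by blast
    then obtain p where p: "ultrafilter_on S p" "p \<notin> \<Union>(u ` H)" by (auto simp: beta_def)
    have "S - A \<in> p" if "A \<in> H" for A
    proof (rule ultrafilter_on_Diff[OF p(1)])
      show "A \<subseteq> S" using that H(1) unfolding E_def by blast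
      have "p \<notin> beta_cl S A" using that p(2) u by blast
      then show "A \<notin> p" using p(1) by (simp add: beta_cl_iff)
    qed
    then have "S \<inter> (\<Inter>A\<in>H. S - A) \<in> p" by (rule ultrafilter_on_finite_INT[OF p(1) H(2)])
    then show "S \<inter> \<Inter>\<G> \<noteq> {}" using ultrafilter_on_empty[OF p(1)] H(3) by metis
  qed blast
  then obtain p where p: "ultrafilter_on S p" "(-) S ` E \<subseteq> p"
    by (rule has_fip_extends_to_ultrafilter)
  then have "p \<in> \<Union>\<U>" using cov by (auto simp: beta_def)
  then obtain U where U: "U \<in> \<U>" "p \<in> U" by blast
  then obtain A where A: "A \<subseteq> S" "A \<in> p" "beta_cl S A \<subseteq> U" using op openin_beta_topD by metis
  then have "A \<in> E" using U(1) unfolding E_def by blast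
  then have "S - A \<in> p" using p(2) by blast
  then show False using A ultrafilter_on_Diff_iff[OF p(1)] by blast
qed

section \<open>Compact subsets of delta S\<close>

lemma delta_ultrafilter:
  assumes "S \<noteq> {}" "p \<in> delta S mul" shows "ultrafilter_on S p"
proof -
  obtain x where "x \<in> S" using assms(1) by blast
  then have "{x} \<in> Pf S" by (auto simp: Pf_def)
  then show ?thesis using assms(2) unfolding delta_def beta_cl_def beta_def by blast
qed

lemma sigma_subset: "F \<in> Pf S \<Longrightarrow> sigma S mul F \<subseteq> S"
  by (auto simp: sigma_def phi_def Pf_def)

text \<open>\<open>P\<close> is left arbitrary so that one argument covers both \<open>k_CR\<close>
  and \<open>CR\<close>. Failing to belong to the set is witnessed by one member of
  \<open>p\<close>: either a set violating \<open>P\<close>, or the complement of some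
  \<open>sigma S mul F\<close>. Hence the complement is a union of basic open sets.\<close>

lemma compactin_delta_property:
  assumes "S \<noteq> {}"
  shows "compactin (delta_top S mul) {p \<in> delta S mul. \<forall>A\<in>p. P A}" (is "compactin _ ?K")
proof -
  have "closedin (beta_top S) ?K"
    unfolding closedin_def
  proof
    show "?K \<subseteq> topspace (beta_top S)"
      using delta_ultrafilter[OF assms] by (auto simp: beta_def)
    define \<A> where
      "\<A> = {A. A \<subseteq> S \<and> \<not> P A} \<union> {S - sigma S mul F |F. F \<in> Pf S}"
    have \<A>S: "A \<subseteq> S" if "A \<in> \<A>" for A using that unfolding \<A>_def by blast
    have "topspace (beta_top S) - ?K = (\<Union>A\<in>\<A>. beta_cl S A)"
    proof (intro set_eqI)
      fix p
      show "p \<in> topspace (beta_top S) - ?K \<longleftrightarrow> p \<in> (\<Union>A\<in>\<A>. beta_cl S A)"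
      proof (cases "ultrafilter_on S p")
        case True
        have "p \<in> delta S mul \<longleftrightarrow> (\<forall>F\<in>Pf S. S - sigma S mul F \<notin> p)"
          using True ultrafilter_on_Diff_iff[OF True sigma_subset]
          by (simp add: delta_def beta_cl_iff)
        moreover have "(\<forall>A\<in>p. P A) \<longleftrightarrow> (\<forall>A. A \<subseteq> S \<and> \<not> P A \<longrightarrow> A \<notin> p)"
          using ultrafilter_on_subset[OF True] by blast
        moreover have "p \<in> (\<Union>A\<in>\<A>. beta_cl S A) \<longleftrightarrow>
            (\<exists>A. A \<subseteq> S \<and> \<not> P A \<and> A \<in> p) \<or> (\<exists>F\<in>Pf S. S - sigma S mul F \<in> p)"
          using True unfolding \<A>_def UN_iff beta_cl_iff by blast
        moreover have "p \<in> topspace (beta_top S)" using True by (simp add: beta_def)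
        ultimately show ?thesis unfolding Diff_iff mem_Collect_eq by metis
      qed (auto simp: beta_def beta_cl_def)
    qed
    moreover have "openin (beta_top S) (\<Union>A\<in>\<A>. beta_cl S A)"
      using \<A>S by (auto intro!: openin_Union openin_beta_cl)
    ultimately show "openin (beta_top S) (topspace (beta_top S) - ?K)" by (simp only:)
  qed
  then show ?thesis
    unfolding delta_top_def compactin_subtopology
    using closedin_compact_space[OF compact_space_beta_top] by blast
qed

section \<open>Adequate partial semigroups\<close>

locale adequate =
  fixes S :: "'a set" and mul :: "'a \<Rightarrow> 'a \<Rightarrow> 'a option"
  assumes adequate: "adequate_partial_semigroup S mul"
begin

lemma carrier_nonempty: "S \<noteq> {}"
  and mul_closed: "x \<in> S \<Longrightarrow> y \<in> S \<Longrightarrow> mul x y = Some z \<Longrightarrow> z \<in> S"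
  and mul_assoc: "x \<in> S \<Longrightarrow> y \<in> S \<Longrightarrow> z \<in> S \<Longrightarrow>
    Option.bind (mul x y) (\<lambda>u. mul u z) = Option.bind (mul y z) (mul x)"
proof -
  have *: "S \<noteq> {}" "\<forall>x\<in>S. \<forall>y\<in>S. \<forall>z. mul x y = Some z \<longrightarrow> z \<in> S"
    "\<forall>x\<in>S. \<forall>y\<in>S. \<forall>z\<in>S.
      Option.bind (mul x y) (\<lambda>u. mul u z) = Option.bind (mul y z) (\<lambda>v. mul x v)"
    using adequate unfolding adequate_partial_semigroup_def partial_semigroup_def
    by - (elim conjE, assumption)+
  show "S \<noteq> {}" by (rule *(1))
  show "x \<in> S \<Longrightarrow> y \<in> S \<Longrightarrow> mul x y = Some z \<Longrightarrow> z \<in> S"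
    by (rule *(2)[rule_format])
  show "x \<in> S \<Longrightarrow> y \<in> S \<Longrightarrow> z \<in> S \<Longrightarrow>
    Option.bind (mul x y) (\<lambda>u. mul u z) = Option.bind (mul y z) (mul x)"
    by (rule *(3)[rule_format])
qed

lemma mul_assoc_left:
  assumes "x \<in> S" "y \<in> S" "z \<in> S" "mul x y = Some u" "mul u z = Some w"
  obtains v where "mul y z = Some v" "mul x v = Some w"
  using mul_assoc[OF assms(1-3)] assms(4,5) by (cases "mul y z") auto

lemma mul_assoc_right:
  assumes "x \<in> S" "y \<in> S" "z \<in> S" "mul y z = Some v" "mul x v = Some w"
  obtains u where "mul x y = Some u" "mul u z = Some w"
  using mul_assoc[OF assms(1-3)] assms(4,5) by (cases "mul x y") auto

section \<open>Transporting membership in sigma along a product\<close>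

lemma sigma_iff:
  "F \<noteq> {} \<Longrightarrow> y \<in> sigma S mul F \<longleftrightarrow> y \<in> S \<and> (\<forall>a\<in>F. mul a y \<noteq> None)"
  unfolding sigma_def phi_def by auto

text \<open>This is {x} together with F * x. It is applied with \<open>x\<close> in
  \<open>sigma S mul F\<close>, where every \<open>mul a x\<close> is defined and \<open>the\<close>
  returns the actual product.\<close>

definition sigma_shift :: "'a set \<Rightarrow> 'a \<Rightarrow> 'a set" where
  "sigma_shift F x = insert x ((\<lambda>a. the (mul a x)) ` F)"

lemma sigma_shift_Pf:
  assumes "F \<in> Pf S" "x \<in> sigma S mul F"
  shows "sigma_shift F x \<in> Pf S"
proof -
  have F: "F \<noteq> {}" "F \<subseteq> S" "finite F" using assms(1) unfolding Pf_def by auto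
  have x: "x \<in> S" "\<forall>a\<in>F. mul a x \<noteq> None" using assms(2) F(1) by (simp_all add: sigma_iff)
  have "the (mul a x) \<in> S" if a: "a \<in> F" for a
  proof -
    have "mul a x = Some (the (mul a x))" using bspec[OF x(2) a] by simp
    moreover have "a \<in> S" using F(2) a by blast
    ultimately show ?thesis using mul_closed x(1) by blast
  qed
  then have "sigma_shift F x \<subseteq> S" using x(1) unfolding sigma_shift_def by blast
  then show ?thesis using F(3) by (simp add: Pf_def sigma_shift_def)
qed

text \<open>For \<open>a\<close> in \<open>F\<close>, both a * x and (a * x) * y are defined, so
  partial associativity makes a * (x * y) defined.\<close>

lemma sigma_shift_mult:
  assumes "F \<in> Pf S" "x \<in> sigma S mul F" "y \<in> sigma S mul (sigma_shift F x)"
  obtains z where "mul x y = Some z" "z \<in> sigma S mul F"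
proof -
  have F: "F \<noteq> {}" "F \<subseteq> S" using assms(1) unfolding Pf_def by auto
  have x: "x \<in> S" using assms(2) F by (simp add: sigma_iff)
  have y: "y \<in> S" "mul x y \<noteq> None" "\<And>a. a \<in> F \<Longrightarrow> mul (the (mul a x)) y \<noteq> None"
    using assms(3) by (auto simp: sigma_iff sigma_shift_def)
  then obtain z where z: "mul x y = Some z" by blast
  have "mul a z \<noteq> None" if a: "a \<in> F" for a
  proof -
    obtain u where u: "mul a x = Some u" using assms(2) F a by (auto simp: sigma_iff)
    then obtain w where "mul u y = Some w" using y(3)[OF a] by auto
    then show ?thesis using mul_assoc_left[of a x y u w] a F x y(1) u z by auto
  qed
  then show thesis using that[OF z] mul_closed[OF x y(1) z] F by (simp add: sigma_iff)
qed

lemma left_quot_iff: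
  "y \<in> left_quot S mul x A \<longleftrightarrow> y \<in> S \<and> (\<exists>z\<in>A. mul x y = Some z)"
  unfolding left_quot_def phi_def by auto

section \<open>Absorbing a factor into an interleaved product\<close>

lemma pprod_closed:
  "set l \<subseteq> S \<Longrightarrow> pprod mul l = Some y \<Longrightarrow> y \<in> S"
proof (induction l arbitrary: y rule: induct_list012)
  case (3 x x' l)
  then obtain z where z: "pprod mul (x' # l) = Some z" "mul x z = Some y"
    by (auto split: bind_splits)
  then have "z \<in> S" using 3 by auto
  then show ?case using mul_closed[OF _ _ z(2)] "3.prems"(1) by simp
qed auto

lemma pprod_Cons: "l \<noteq> [] \<Longrightarrow> pprod mul (x # l) = Option.bind (pprod mul l) (mul x)"
  by (cases l) auto

text \<open>A single use of associativity, x * (b * w) = (x * b) * w, with w the product of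
  \<open>l\<close>. The new head depends on \<open>x\<close> and \<open>b\<close> only, so it can be
  shared by lists that differ in their tails.\<close>

lemma pprod_absorb_left:
  assumes "b \<in> S" "set l \<subseteq> S" "l \<noteq> []" "x \<in> S"
    and "pprod mul (b # l) = Some y" "mul x y = Some z"
  shows "mul x b \<noteq> None \<and> pprod mul (the (mul x b) # l) = Some z"
proof -
  obtain w where w: "pprod mul l = Some w" "mul b w = Some y"
    using assms(3,5) by (auto simp: pprod_Cons split: bind_splits)
  obtain u where "mul x b = Some u" "mul u w = Some z"
    using mul_assoc_right[OF assms(4,1) pprod_closed[OF assms(2) w(1)] w(2) assms(6)] .
  then show ?thesis using w(1) assms(3) by (simp add: pprod_Cons)
qed

text \<open>Products are bracketed to the right, so \<open>z\<close> has to travel inwards past each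
  entry by (x * v) * z = x * (v * z) until it meets \<open>c\<close>; hence the induction on
  \<open>l\<close>.\<close>

lemma pprod_absorb_right:
  assumes "c \<in> S" "set l \<subseteq> S" "z \<in> S"
    and "pprod mul (l @ [c]) = Some y" "mul y z = Some w"
  shows "mul c z \<noteq> None \<and> pprod mul (l @ [the (mul c z)]) = Some w"
  using assms(2,4,5)
proof (induction l arbitrary: y w)
  case (Cons x l)
  then obtain v where v: "pprod mul (l @ [c]) = Some v" "mul x v = Some y"
    by (auto simp: pprod_Cons split: bind_splits)
  have "v \<in> S" using pprod_closed[OF _ v(1)] Cons.prems(1) assms(1) by auto
  moreover have "x \<in> S" using Cons.prems(1) by simp
  ultimately obtain v' where v': "mul v z = Some v'" "mul x v' = Some w"
    using mul_assoc_left[OF _ _ assms(3) v(2) Cons.prems(3)] by blast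
  have "mul c z \<noteq> None \<and> pprod mul (l @ [the (mul c z)]) = Some v'"
    using Cons.IH[OF _ v(1) v'(1)] Cons.prems(1) by simp
  then show ?case using v'(2) by (simp add: pprod_Cons)
qed simp

lemma adequate_seqs_closed: "f \<in> adequate_seqs S mul \<Longrightarrow> n \<ge> 1 \<Longrightarrow> f n \<in> S"
  unfolding adequate_seqs_def by (auto simp: PiE_iff)

text \<open>The updated coefficient does not mention \<open>f\<close>, so one new \<open>a\<close>
  serves all sequences at once; \<open>t\<close> is kept, and with it the bound
  \<open>r\<close>.\<close>

lemma interleaved_absorb_left:
  assumes "m \<ge> 1" "a \<in> {1..m+1} \<rightarrow> S" "t \<in> {1..m} \<rightarrow> {1..r}" "f \<in> adequate_seqs S mul" "x \<in> S"
    and "interleaved_prod mul m a t f = Some y" "mul x y = Some z"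
  shows "mul x (a 1) \<noteq> None \<and> interleaved_prod mul m (a(1 := the (mul x (a 1)))) t f = Some z"
proof -
  \<comment> \<open>The list without its first entry reads \<open>a'\<close> only at the indices 2
    to m+1, so changing \<open>a 1\<close> leaves it alone.\<close>
  define l where
    "l a' = f (t 1) # concat (map (\<lambda>i. [a' i, f (t i)]) [2..<m+1]) @ [a' (m+1)]" for a' :: "nat \<Rightarrow> 'a"
  have list: "concat (map (\<lambda>i. [a' i, f (t i)]) [1..<m+1]) @ [a' (m+1)] = a' 1 # l a'" for a'
    using assms(1) unfolding l_def by (subst upt_conv_Cons) (auto simp: numeral_2_eq_2)
  have upd: "l (a(1 := b)) = l a" for b
    using assms(1) unfolding l_def
    by (auto intro!: arg_cong[where f = concat] map_cong)
  have "t i \<ge> 1" if "i \<in> {1..m}" for i using that assms(3) by auto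
  then have "f (t i) \<in> S" if "i \<in> {1..m}" for i using that adequate_seqs_closed assms(4) by blast
  then have "set (l a) \<subseteq> S" "a 1 \<in> S" "l a \<noteq> []"
    using assms(1,2) unfolding l_def by (auto simp: Pi_iff)
  then show ?thesis
    using pprod_absorb_left[of "a 1" "l a" x y z] assms(5-7)
    unfolding interleaved_prod_def list upd by simp
qed

lemma interleaved_absorb_right:
  assumes "m \<ge> 1" "a \<in> {1..m+1} \<rightarrow> S" "t \<in> {1..m} \<rightarrow> {1..r}" "f \<in> adequate_seqs S mul" "z \<in> S"
    and "interleaved_prod mul m a t f = Some y" "mul y z = Some w"
  shows "mul (a (m+1)) z \<noteq> None \<and>
    interleaved_prod mul m (a(m+1 := the (mul (a (m+1)) z))) t f = Some w"
proof -
  \<comment> \<open>The list without its last entry reads \<open>a'\<close> only at the indices 1 to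
    m, so changing \<open>a (m+1)\<close> leaves it alone.\<close>
  define l where "l a' = concat (map (\<lambda>i. [a' i, f (t i)]) [1..<m+1])" for a' :: "nat \<Rightarrow> 'a"
  have upd: "l (a(m+1 := b)) = l a" for b
    unfolding l_def by (auto intro!: arg_cong[where f = concat] map_cong)
  have "t i \<ge> 1" if "i \<in> {1..m}" for i using that assms(3) by auto
  then have "f (t i) \<in> S" if "i \<in> {1..m}" for i using that adequate_seqs_closed assms(4) by blast
  then have "set (l a) \<subseteq> S" "a (m+1) \<in> S"
    using assms(1,2) unfolding l_def by (auto simp: Pi_iff)
  then show ?thesis
    using pprod_absorb_right[of "a (m+1)" "l a" z y w] assms(5-7)
    unfolding interleaved_prod_def l_def[symmetric] upd by simp
qed

section \<open>Absorption for k-CR sets\<close>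

text \<open>The innermost condition of \<open>k_CR_set\<close>, with the target set freed from the
  form \<open>A \<inter> sigma S mul L\<close>, so that absorption can change the target while
  keeping \<open>r\<close> and \<open>F\<close>.\<close>

definition CR_pattern :: "nat \<Rightarrow> (nat \<Rightarrow> 'a) set \<Rightarrow> 'a set \<Rightarrow> bool" where
  "CR_pattern r F B \<longleftrightarrow>
     (\<exists>m\<ge>1. \<exists>a \<in> {1..m+1} \<rightarrow> S. \<exists>t \<in> {1..m} \<rightarrow> {1..r}. strict_mono_on {1..m} t \<and>
        (\<forall>f\<in>F. \<exists>y\<in>B. interleaved_prod mul m a t f = Some y))"

lemma CR_patternI:
  assumes "m \<ge> 1" "a \<in> {1..m+1} \<rightarrow> S" "t \<in> {1..m} \<rightarrow> {1..r}" "strict_mono_on {1..m} t"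
    and "\<And>f. f \<in> F \<Longrightarrow> \<exists>y\<in>B. interleaved_prod mul m a t f = Some y"
  shows "CR_pattern r F B"
  unfolding CR_pattern_def
  by (intro exI[of _ m] bexI[of _ a] bexI[of _ t] conjI ballI) (use assms in simp_all)

lemma CR_patternE:
  assumes "CR_pattern r F B"
  obtains m a t y where "m \<ge> 1" "a \<in> {1..m+1} \<rightarrow> S" "t \<in> {1..m} \<rightarrow> {1..r}"
    "strict_mono_on {1..m} t"
    "\<And>f. f \<in> F \<Longrightarrow> y f \<in> B" "\<And>f. f \<in> F \<Longrightarrow> interleaved_prod mul m a t f = Some (y f)"
proof -
  obtain m a t where mat: "m \<ge> 1" "a \<in> {1..m+1} \<rightarrow> S" "t \<in> {1..m} \<rightarrow> {1..r}"
      "strict_mono_on {1..m} t"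
    and val: "\<forall>f\<in>F. \<exists>y. y \<in> B \<and> interleaved_prod mul m a t f = Some y"
    using assms unfolding CR_pattern_def by blast
  obtain y where "\<forall>f\<in>F. y f \<in> B \<and> interleaved_prod mul m a t f = Some (y f)"
    using bchoice[OF val] by (elim exE)
  then show thesis using that[OF mat, of y] by simp
qed

lemma k_CR_set_iff:
  "k_CR_set S mul k A \<longleftrightarrow> A \<subseteq> S \<and>
     (\<forall>L\<in>Pf S. \<exists>r\<ge>1. \<forall>F\<in>Pf (adequate_seqs S mul). card F \<le> k \<longrightarrow>
        CR_pattern r F (A \<inter> sigma S mul L))"
  unfolding k_CR_set_def CR_pattern_def by (rule refl)

lemma CR_pattern_absorb_left:
  assumes F: "F \<in> Pf (adequate_seqs S mul)" and "CR_pattern r F B" and x: "x \<in> S"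
    and BC: "\<And>y. y \<in> B \<Longrightarrow> \<exists>z\<in>C. mul x y = Some z"
  shows "CR_pattern r F C"
proof -
  obtain m a t y where mat: "m \<ge> 1" "a \<in> {1..m+1} \<rightarrow> S" "t \<in> {1..m} \<rightarrow> {1..r}"
    and mono: "strict_mono_on {1..m} t"
    and y: "\<And>f. f \<in> F \<Longrightarrow> y f \<in> B" "\<And>f. f \<in> F \<Longrightarrow> interleaved_prod mul m a t f = Some (y f)"
    using CR_patternE[OF assms(2)] by metis
  let ?b = "the (mul x (a 1))"
  have val: "mul x (a 1) \<noteq> None \<and> (\<exists>z\<in>C. interleaved_prod mul m (a(1 := ?b)) t f = Some z)"
    if f: "f \<in> F" for f
  proof -
    obtain z where z: "z \<in> C" "mul x (y f) = Some z" using BC[OF y(1)[OF f]] by blast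
    have "f \<in> adequate_seqs S mul" using F f by (auto simp: Pf_def)
    from interleaved_absorb_left[OF mat this x y(2)[OF f] z(2)] show ?thesis using z(1) by blast
  qed
  \<comment> \<open>Some sequence in \<open>F\<close> is needed to see that the new coefficient is a
    genuine product, hence an element of \<open>S\<close>.\<close>
  obtain f0 where "f0 \<in> F" using F by (auto simp: Pf_def)
  then have "mul x (a 1) = Some ?b" using val[of f0] by simp
  moreover have "a 1 \<in> S" using mat(1,2) by auto
  ultimately have "?b \<in> S" using mul_closed x by blast
  then have "a(1 := ?b) \<in> {1..m+1} \<rightarrow> S" using mat(2) by (simp add: Pi_iff)
  then show ?thesis by (rule CR_patternI[OF mat(1) _ mat(3) mono]) (use val in blast)
qed

text \<open>On the right the factor must suit the values of all sequences in \<open>F\<close>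
  simultaneously. As \<open>F\<close> is finite, these values form a finite set \<open>Y\<close>,
  and \<open>z\<close> may be chosen after seeing it.\<close>

lemma CR_pattern_absorb_right:
  assumes F: "F \<in> Pf (adequate_seqs S mul)" and "CR_pattern r F B"
    and BC: "\<And>Y. finite Y \<Longrightarrow> Y \<subseteq> B \<Longrightarrow> \<exists>z\<in>S. \<forall>y\<in>Y. \<exists>w\<in>C. mul y z = Some w"
  shows "CR_pattern r F C"
proof -
  obtain m a t y where mat: "m \<ge> 1" "a \<in> {1..m+1} \<rightarrow> S" "t \<in> {1..m} \<rightarrow> {1..r}"
    and mono: "strict_mono_on {1..m} t"
    and y: "\<And>f. f \<in> F \<Longrightarrow> y f \<in> B" "\<And>f. f \<in> F \<Longrightarrow> interleaved_prod mul m a t f = Some (y f)"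
    using CR_patternE[OF assms(2)] by metis
  have "finite (y ` F)" "y ` F \<subseteq> B" using F y(1) by (auto simp: Pf_def)
  then obtain z where z: "z \<in> S" "\<forall>v\<in>y ` F. \<exists>w\<in>C. mul v z = Some w" using BC by meson
  let ?b = "the (mul (a (m+1)) z)"
  have val: "mul (a (m+1)) z \<noteq> None \<and>
      (\<exists>w\<in>C. interleaved_prod mul m (a(m+1 := ?b)) t f = Some w)" if f: "f \<in> F" for f
  proof -
    obtain w where w: "w \<in> C" "mul (y f) z = Some w" using z(2) f by blast
    have "f \<in> adequate_seqs S mul" using F f by (auto simp: Pf_def)
    from interleaved_absorb_right[OF mat this z(1) y(2)[OF f] w(2)] show ?thesis using w(1) by blast
  qed
  obtain f0 where "f0 \<in> F" using F by (auto simp: Pf_def)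
  then have "mul (a (m+1)) z = Some ?b" using val[of f0] by simp
  moreover have "a (m+1) \<in> S" using mat(2) by auto
  ultimately have "?b \<in> S" using mul_closed z(1) by blast
  then have "a(m+1 := ?b) \<in> {1..m+1} \<rightarrow> S" using mat(2) by (simp add: Pi_iff)
  then show ?thesis by (rule CR_patternI[OF mat(1) _ mat(3) mono]) (use val in blast)
qed

text \<open>The factor \<open>x\<close> depends on \<open>L\<close> alone, so the bound
  \<open>r\<close> that the quotient has for the shifted set \<open>sigma_shift L x\<close> is
  available before \<open>F\<close> is given and also works for \<open>A\<close>.\<close>

lemma k_CR_set_of_left_quot:
  assumes "A \<subseteq> S"
    and "\<And>L. L \<in> Pf S \<Longrightarrow> \<exists>x\<in>sigma S mul L. k_CR_set S mul k (left_quot S mul x A)"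
  shows "k_CR_set S mul k A"
  unfolding k_CR_set_iff
proof (intro conjI ballI assms(1))
  fix L assume L: "L \<in> Pf S"
  obtain x where x: "x \<in> sigma S mul L" and CR: "k_CR_set S mul k (left_quot S mul x A)"
    using assms(2)[OF L] by blast
  have xS: "x \<in> S" using x L by (auto simp: sigma_iff Pf_def)
  obtain r where "r \<ge> 1" and r: "\<And>F. F \<in> Pf (adequate_seqs S mul) \<Longrightarrow> card F \<le> k \<Longrightarrow>
      CR_pattern r F (left_quot S mul x A \<inter> sigma S mul (sigma_shift L x))"
    using CR sigma_shift_Pf[OF L x] unfolding k_CR_set_iff by blast
  have BC: "\<exists>z\<in>A \<inter> sigma S mul L. mul x y = Some z"
    if y: "y \<in> left_quot S mul x A \<inter> sigma S mul (sigma_shift L x)" for y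
  proof -
    obtain z where "mul x y = Some z" "z \<in> sigma S mul L"
      using sigma_shift_mult[OF L x] y by blast
    then show ?thesis using y by (auto simp: left_quot_iff)
  qed
  show "\<exists>r\<ge>1. \<forall>F\<in>Pf (adequate_seqs S mul). card F \<le> k \<longrightarrow> CR_pattern r F (A \<inter> sigma S mul L)"
    using \<open>r \<ge> 1\<close> CR_pattern_absorb_left[OF _ r xS BC] by blast
qed

lemma delta_sigma: "p \<in> delta S mul \<Longrightarrow> F \<in> Pf S \<Longrightarrow> sigma S mul F \<in> p"
  unfolding delta_def by (simp add: beta_cl_iff)

lemma delta_ultra: "p \<in> delta S mul \<Longrightarrow> ultrafilter_on S p"
  by (rule delta_ultrafilter[OF carrier_nonempty])

text \<open>The bound \<open>r\<close> comes from the set of \<open>x\<close> with large quotient,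
  for the same \<open>L\<close>. The right factor \<open>z\<close> is picked only after
  \<open>F\<close>, which is harmless because absorbing it does not alter \<open>r\<close>.\<close>

lemma k_CR_set_of_quotients_in_ultrafilter:
  assumes A: "A \<subseteq> S" and q: "q \<in> delta S mul"
    and CR: "k_CR_set S mul k {x \<in> S. left_quot S mul x A \<in> q}"
  shows "k_CR_set S mul k A"
  unfolding k_CR_set_iff
proof (intro conjI ballI A)
  let ?B = "{x \<in> S. left_quot S mul x A \<in> q}"
  have uq: "ultrafilter_on S q" using delta_ultra[OF q] .
  fix L assume L: "L \<in> Pf S"
  obtain r where "r \<ge> 1" and r: "\<And>F. F \<in> Pf (adequate_seqs S mul) \<Longrightarrow> card F \<le> k \<Longrightarrow>
      CR_pattern r F (?B \<inter> sigma S mul L)"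
    using CR L unfolding k_CR_set_iff by blast
  have BC: "\<exists>z\<in>S. \<forall>y\<in>Y. \<exists>w\<in>A \<inter> sigma S mul L. mul y z = Some w"
    if Y: "finite Y" "Y \<subseteq> ?B \<inter> sigma S mul L" for Y
  proof -
    \<comment> \<open>A \<open>z\<close> in \<open>?X y\<close> sends y * z into \<open>A\<close> by
      the quotient and into \<open>sigma S mul L\<close> by the shift. Both sets belong to
      \<open>q\<close>, so finitely many \<open>?X y\<close> have a common point.\<close>
    let ?X = "\<lambda>y. left_quot S mul y A \<inter> sigma S mul (sigma_shift L y)"
    have "?X y \<in> q" if y: "y \<in> Y" for y
    proof (rule ultrafilter_on_Int[OF uq])
      show "left_quot S mul y A \<in> q" using Y(2) y by blast
      show "sigma S mul (sigma_shift L y) \<in> q"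
        using Y(2) y by (intro delta_sigma[OF q] sigma_shift_Pf[OF L]) blast
    qed
    then have "S \<inter> (\<Inter>y\<in>Y. ?X y) \<in> q" by (rule ultrafilter_on_finite_INT[OF uq Y(1)])
    then have "S \<inter> (\<Inter>y\<in>Y. ?X y) \<noteq> {}" using ultrafilter_on_empty[OF uq] by metis
    then obtain z where z: "z \<in> S" "\<And>y. y \<in> Y \<Longrightarrow> z \<in> ?X y" by blast
    have "\<exists>w\<in>A \<inter> sigma S mul L. mul y z = Some w" if y: "y \<in> Y" for y
    proof -
      have "y \<in> sigma S mul L" using Y(2) y by blast
      moreover have "z \<in> sigma S mul (sigma_shift L y)" using z(2)[OF y] by blast
      ultimately obtain w where "mul y z = Some w" "w \<in> sigma S mul L"
        by (rule sigma_shift_mult[OF L])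
      then show ?thesis using z(2)[OF y] by (auto simp: left_quot_iff)
    qed
    then show ?thesis using z(1) by blast
  qed
  show "\<exists>r\<ge>1. \<forall>F\<in>Pf (adequate_seqs S mul). card F \<le> k \<longrightarrow> CR_pattern r F (A \<inter> sigma S mul L)"
    using \<open>r \<ge> 1\<close> CR_pattern_absorb_right[OF _ r BC] by blast
qed

section \<open>The ideals\<close>

lemma left_quot_subset: "left_quot S mul x A \<subseteq> S"
  by (auto simp: left_quot_iff)

lemma left_quot_Int: "left_quot S mul x (A \<inter> B) = left_quot S mul x A \<inter> left_quot S mul x B"
  by (auto simp: left_quot_iff)

lemma left_quot_mono: "A \<subseteq> B \<Longrightarrow> left_quot S mul x A \<subseteq> left_quot S mul x B"
  unfolding left_quot_def by blast

lemma left_quot_Un_Diff: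
  assumes "x \<in> S"
  shows "phi S mul x \<subseteq> left_quot S mul x A \<union> left_quot S mul x (S - A)"
proof
  fix y assume "y \<in> phi S mul x"
  then obtain z where "y \<in> S" "mul x y = Some z" by (auto simp: phi_def)
  moreover from this have "z \<in> S" using mul_closed assms by blast
  ultimately show "y \<in> left_quot S mul x A \<union> left_quot S mul x (S - A)"
    by (auto simp: left_quot_iff)
qed

text \<open>The map \<open>?Q\<close> from \<open>A\<close> to the set of \<open>x\<close> with
  x^{-1}A in \<open>q\<close> respects the empty set, inclusions, intersections and complements as
  far as needed, so pulling \<open>p\<close> back along it gives an ultrafilter.\<close>

lemma uf_mult_ultrafilter:
  assumes p: "p \<in> delta S mul" and q: "q \<in> delta S mul"
  shows "ultrafilter_on S (uf_mult S mul p q)"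
proof -
  let ?Q = "\<lambda>A. {x\<in>S. left_quot S mul x A \<in> q}"
  have up: "ultrafilter_on S p" and uq: "ultrafilter_on S q"
    using delta_ultra[OF p] delta_ultra[OF q] .
  have phi: "phi S mul x \<in> q" if "x \<in> S" for x
    using delta_sigma[OF q, of "{x}"] that by (simp add: Pf_def sigma_def)
  have Q0: "?Q {} = {}" using ultrafilter_on_empty[OF uq] by (simp add: left_quot_def)
  have QInt: "?Q A \<inter> ?Q B \<subseteq> ?Q (A \<inter> B)" for A B
    unfolding left_quot_Int using ultrafilter_on_Int[OF uq] by blast
  have Qmono: "?Q A \<subseteq> ?Q B" if "A \<subseteq> B" for A B
    using ultrafilter_on_mono[OF uq _ left_quot_mono[OF that] left_quot_subset] by blast
  \<comment> \<open>Because multiplication is partial, S - x^{-1}A may also contain points where x *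
    y is undefined. Intersecting with \<open>phi S mul x\<close>, a member of \<open>q\<close>,
    removes them.\<close>
  have QDiff: "S - ?Q A \<subseteq> ?Q (S - A)" for A
  proof
    fix x assume x: "x \<in> S - ?Q A"
    then have "left_quot S mul x A \<notin> q" by simp
    then have "S - left_quot S mul x A \<in> q"
      by (rule ultrafilter_on_Diff[OF uq left_quot_subset])
    then have "phi S mul x \<inter> (S - left_quot S mul x A) \<in> q"
      using phi[of x] x by (intro ultrafilter_on_Int[OF uq]) simp_all
    moreover have "phi S mul x \<inter> (S - left_quot S mul x A) \<subseteq> left_quot S mul x (S - A)"
      using left_quot_Un_Diff[of x A] x by blast
    ultimately have "left_quot S mul x (S - A) \<in> q"
      by (rule ultrafilter_on_mono[OF uq _ _ left_quot_subset])
    then show "x \<in> ?Q (S - A)" using x by simp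
  qed
  have QS: "?Q S = S" using QDiff[of "{}"] unfolding Q0 by auto
  have memD: "A \<subseteq> S" "?Q A \<in> p" if "A \<in> uf_mult S mul p q" for A
    using that unfolding uf_mult_def by simp_all
  have memI: "A \<in> uf_mult S mul p q" if "A \<subseteq> S" "X \<in> p" "X \<subseteq> ?Q A" for A X
    unfolding uf_mult_def using that(1) ultrafilter_on_mono[OF up that(2,3)] by simp
  show ?thesis
    unfolding ultrafilter_on_def
  proof (intro conjI ballI allI impI)
    show "uf_mult S mul p q \<subseteq> Pow S" using memD(1) by blast
    show "S \<in> uf_mult S mul p q"
      by (rule memI[OF _ ultrafilter_on_carrier[OF up]]) (simp_all only: QS order.refl)
    show "{} \<notin> uf_mult S mul p q"
      using memD(2)[of "{}"] ultrafilter_on_empty[OF up] unfolding Q0 by blast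
  next
    fix A B assume A: "A \<in> uf_mult S mul p q" and B: "B \<in> uf_mult S mul p q"
    show "A \<inter> B \<in> uf_mult S mul p q"
    proof (rule memI[OF _ _ QInt])
      show "A \<inter> B \<subseteq> S" using memD(1)[OF A] by blast
      show "?Q A \<inter> ?Q B \<in> p" by (rule ultrafilter_on_Int[OF up memD(2)[OF A] memD(2)[OF B]])
    qed
  next
    fix A B assume A: "A \<in> uf_mult S mul p q" and AB: "A \<subseteq> B \<and> B \<subseteq> S"
    show "B \<in> uf_mult S mul p q"
      by (rule memI[OF conjunct2[OF AB] memD(2)[OF A] Qmono[OF conjunct1[OF AB]]])
  next
    fix A assume A: "A \<subseteq> S"
    show "A \<in> uf_mult S mul p q \<or> S - A \<in> uf_mult S mul p q"
    proof (cases "?Q A \<in> p")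
      case True
      then show ?thesis using memI[OF A True order.refl] by blast
    next
      case False
      have "S - ?Q A \<in> p" by (rule ultrafilter_on_Diff[OF up _ False]) blast
      then show ?thesis using memI[OF Diff_subset _ QDiff] by blast
    qed
  qed
qed

text \<open>For \<open>x\<close> in \<open>sigma S mul F\<close>, the quotient of
  \<open>sigma S mul F\<close> by \<open>x\<close> contains the sigma of the shifted set, which is
  in \<open>q\<close>. So the set of such \<open>x\<close> includes \<open>sigma S mul F\<close>, a
  member of \<open>p\<close>.\<close>

lemma uf_mult_delta:
  assumes p: "p \<in> delta S mul" and q: "q \<in> delta S mul"
  shows "uf_mult S mul p q \<in> delta S mul"
proof -
  have up: "ultrafilter_on S p" and uq: "ultrafilter_on S q" using delta_ultra p q by auto
  have "sigma S mul F \<in> uf_mult S mul p q" if F: "F \<in> Pf S" for F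
  proof -
    have "left_quot S mul x (sigma S mul F) \<in> q" if x: "x \<in> sigma S mul F" for x
    proof (rule ultrafilter_on_mono[OF uq])
      show "sigma S mul (sigma_shift F x) \<in> q" using delta_sigma[OF q sigma_shift_Pf[OF F x]] .
      show "sigma S mul (sigma_shift F x) \<subseteq> left_quot S mul x (sigma S mul F)"
      proof
        fix y assume y: "y \<in> sigma S mul (sigma_shift F x)"
        then show "y \<in> left_quot S mul x (sigma S mul F)"
          using sigma_shift_mult[OF F x y] by (auto simp: left_quot_iff sigma_iff sigma_shift_def)
      qed
    qed (auto simp: left_quot_iff)
    moreover have sub: "sigma S mul F \<subseteq> S" using F by (rule sigma_subset)
    ultimately have "sigma S mul F \<subseteq> {x\<in>S. left_quot S mul x (sigma S mul F) \<in> q}" by blast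
    then have "{x\<in>S. left_quot S mul x (sigma S mul F) \<in> q} \<in> p"
      by (rule ultrafilter_on_mono[OF up delta_sigma[OF p F]]) simp
    then show ?thesis using sub unfolding uf_mult_def by blast
  qed
  then show ?thesis
    using uf_mult_ultrafilter[OF p q] by (auto simp: delta_def beta_cl_iff)
qed

section \<open>The ideal property\<close>

text \<open>For p * q, a point \<open>x\<close> of \<open>sigma S mul L\<close> with x^{-1}A in
  \<open>q\<close> has a k-CR quotient, and \<open>x\<close> is absorbed on the left. For q * p, the
  set of \<open>x\<close> with x^{-1}A in \<open>p\<close> belongs to \<open>q\<close>, so it is
  k-CR, and absorption happens on the right.\<close>

lemma k_CR_ideal:
  assumes p: "p \<in> delta S mul" and q: "q \<in> k_CR S mul k"
  shows "uf_mult S mul p q \<in> k_CR S mul k \<and> uf_mult S mul q p \<in> k_CR S mul k"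
proof -
  have qd: "q \<in> delta S mul" and CR: "\<And>A. A \<in> q \<Longrightarrow> k_CR_set S mul k A"
    using q unfolding k_CR_def by auto
  have up: "ultrafilter_on S p" using delta_ultra p by auto
  have "k_CR_set S mul k A" if A: "A \<in> uf_mult S mul p q" for A
  proof (rule k_CR_set_of_left_quot)
    show "A \<subseteq> S" using A unfolding uf_mult_def by blast
    fix L assume L: "L \<in> Pf S"
    have "{x\<in>S. left_quot S mul x A \<in> q} \<inter> sigma S mul L \<in> p"
      using A delta_sigma[OF p L] ultrafilter_on_Int[OF up] unfolding uf_mult_def by blast
    then have "{x\<in>S. left_quot S mul x A \<in> q} \<inter> sigma S mul L \<noteq> {}"
      using ultrafilter_on_empty[OF up] by metis
    then show "\<exists>x\<in>sigma S mul L. k_CR_set S mul k (left_quot S mul x A)" using CR by blast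
  qed
  moreover have "k_CR_set S mul k A" if "A \<in> uf_mult S mul q p" for A
  proof (rule k_CR_set_of_quotients_in_ultrafilter[OF _ p])
    show "A \<subseteq> S" using that unfolding uf_mult_def by blast
    show "k_CR_set S mul k {x \<in> S. left_quot S mul x A \<in> p}"
      using that unfolding uf_mult_def by (intro CR) blast
  qed
  ultimately show ?thesis
    using uf_mult_delta[OF p qd] uf_mult_delta[OF qd p] by (simp add: k_CR_def)
qed

text \<open>Presents \<open>CR\<close> as an intersection of the sets \<open>k_CR\<close>, through
  which the ideal property passes from each \<open>k\<close> to \<open>CR\<close>.\<close>

lemma CR_iff: "p \<in> CR S mul \<longleftrightarrow> (\<forall>k\<ge>1. p \<in> k_CR S mul k)"
proof
  show "p \<in> CR S mul \<Longrightarrow> \<forall>k\<ge>1. p \<in> k_CR S mul k"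
    by (simp add: CR_def k_CR_def CR_set_def)
  assume *: "\<forall>k\<ge>1. p \<in> k_CR S mul k"
  \<comment> \<open>The instance k = 1 supplies membership in \<open>delta S mul\<close>.\<close>
  then have "p \<in> k_CR S mul 1" by simp
  then show "p \<in> CR S mul" using * by (simp add: CR_def k_CR_def CR_set_def)
qed

end

theorem theorem3p9:
  fixes S :: "'a set" and mul :: "'a \<Rightarrow> 'a \<Rightarrow> 'a option"
  assumes "adequate_partial_semigroup S mul"
  shows "(\<forall>k\<ge>1. k_CR S mul k \<noteq> {} \<longrightarrow>
            compactin (delta_top S mul) (k_CR S mul k) \<and>
            two_sided_ideal (delta S mul) (uf_mult S mul) (k_CR S mul k))
       \<and> (CR S mul \<noteq> {} \<longrightarrow>
            compactin (delta_top S mul) (CR S mul) \<and>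
            two_sided_ideal (delta S mul) (uf_mult S mul) (CR S mul))"
proof -
  interpret adequate S mul by (rule adequate.intro[OF assms])
  have compact: "compactin (delta_top S mul) (k_CR S mul k)"
    "compactin (delta_top S mul) (CR S mul)" for k
    unfolding k_CR_def CR_def by (rule compactin_delta_property[OF carrier_nonempty])+
  have sub: "k_CR S mul k \<subseteq> delta S mul" "CR S mul \<subseteq> delta S mul" for k
    unfolding k_CR_def CR_def by blast+
  have "two_sided_ideal (delta S mul) (uf_mult S mul) (k_CR S mul k)"
    if "k_CR S mul k \<noteq> {}" for k
    unfolding two_sided_ideal_def using that sub(1) k_CR_ideal by simp
  moreover have "two_sided_ideal (delta S mul) (uf_mult S mul) (CR S mul)" if "CR S mul \<noteq> {}"
    unfolding two_sided_ideal_def using that sub(2) k_CR_ideal by (simp add: CR_iff)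
  ultimately show ?thesis using compact by blast
qed

end
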